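(* Let $G$ be a strongly regular graph with parameters $(n,k,\lambda,\mu)$ and diameter $2$. Then the formal magnitude, the $q$-spectrum and the transition $q$-spectrum of $G$ are determined solely by $(n,k,\lambda,\mu)$. That is, any two strongly regular graphs of diameter $2$ with the same parameters $(n,k,\lambda,\mu)$ have the same formal magnitude, the same $q$-spectrum and the same transition $q$-spectrum.
   Context: Graphs are finite, connected, undirected and simple. The vertex set $\{x_1,\dots,x_n\}$ of a graph is regarded as a finite metric space with $d_{ij}=d(x_i,x_j)$ the length of a shortest path between $x_i$ and $x_j$. Let $q$ be a formal parameter (equivalently, $q$ ranges over real numbers in $(0,1)$). The similarity matrix is $Z(q)=(q^{d_{ij}})_{i,j}$. The $q$-spectrum is the multiset of eigenvalues of $Z(q)$. With $\pi_i=\sum_{j=1}^n q^{d_{ij}}$, the transition similarity matrix is $P(q)=(q^{d_{ij}}/\pi_i)_{i,j}$, and the transition $q$-spectrum is the multiset of eigenvalues of $P(q)$. Two graphs have the same ($q$- or transition $q$-) spectrum if the corresponding multisets agree for all $q\in(0,1)$; equivalently, the corresponding characteristic polynomials coincide. The formal magnitude is the sum of all entries of $Z(q)^{-1}$, the inverse being taken over the field of fractions of the ring of generalized polynomials in $q$ (real exponents allowed; for graphs, ordinary rational functions of $q$). A strongly regular graph with parameters $(n,k,\lambda,\mu)$ is a graph with $n$ vertices in which every vertex has degree $k$, every two adjacent vertices have exactly $\lambda$ common neighbours, and every two distinct non-adjacent vertices have exactly $\mu$ common neighbours. *)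

theory Defs
  imports
    "Graph_Theory.Graph_Theory"
    "Jordan_Normal_Form.Char_Poly"
    "Jordan_Normal_Form.Gauss_Jordan_Elimination"
    "HOL-Computational_Algebra.Normalized_Fraction"
    "HOL.Complex"
begin

(* A finite simple graph is a pair_graph: a finite, loop-free, symmetric relation on a finite
   vertex set, so that the edge {u,v} is the pair of arcs (u,v), (v,u). *)

definition graph_dist :: "'a pair_pre_digraph \<Rightarrow> 'a \<Rightarrow> 'a \<Rightarrow> nat" where
  "graph_dist G u v =
     (LEAST l. \<exists>p. pre_digraph.apath (with_proj G) u p v \<and> length p = l)"

definition diameter :: "'a pair_pre_digraph \<Rightarrow> nat" where
  "diameter G = Max {graph_dist G u v | u v. u \<in> pverts G \<and> v \<in> pverts G}"

(* By symmetry of the arc relation the out-degree is the degree in the undirected sense.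
   Connectedness and the diameter are not part of this definition. *)
definition strongly_regular :: "'a pair_pre_digraph \<Rightarrow> nat \<Rightarrow> nat \<Rightarrow> nat \<Rightarrow> nat \<Rightarrow> bool" where
  "strongly_regular G n k l m \<longleftrightarrow>
     pair_graph G \<and> card (pverts G) = n \<and>
     (\<forall>u \<in> pverts G. out_degree (with_proj G) u = k) \<and>
     (\<forall>u \<in> pverts G. \<forall>v \<in> pverts G. (u, v) \<in> parcs G \<longrightarrow>
        card {w \<in> pverts G. (u, w) \<in> parcs G \<and> (v, w) \<in> parcs G} = l) \<and>
     (\<forall>u \<in> pverts G. \<forall>v \<in> pverts G. u \<noteq> v \<and> (u, v) \<notin> parcs G \<longrightarrow>
        card {w \<in> pverts G. (u, w) \<in> parcs G \<and> (v, w) \<in> parcs G} = m)"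

(* The labelling x_1, ..., x_n of the vertices by which the matrices are indexed. *)
definition vertex_enumeration :: "'a pair_pre_digraph \<Rightarrow> 'a list \<Rightarrow> bool" where
  "vertex_enumeration G xs \<longleftrightarrow> distinct xs \<and> set xs = pverts G"

(* The parameter q lives in an arbitrary coefficient ring, so that it can be instantiated both by
   a number in (0,1) and by the formal variable. *)
definition similarity_matrix ::
    "'a pair_pre_digraph \<Rightarrow> 'a list \<Rightarrow> 'b::comm_ring_1 \<Rightarrow> 'b mat" where
  "similarity_matrix G xs q =
     mat (length xs) (length xs) (\<lambda>(i, j). q ^ graph_dist G (xs ! i) (xs ! j))"

definition transition_similarity_matrix ::
    "'a pair_pre_digraph \<Rightarrow> 'a list \<Rightarrow> 'b::field \<Rightarrow> 'b mat" where
  "transition_similarity_matrix G xs q =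
     mat (length xs) (length xs) (\<lambda>(i, j).
       q ^ graph_dist G (xs ! i) (xs ! j) /
       (\<Sum>r<length xs. q ^ graph_dist G (xs ! i) (xs ! r)))"

(* Eigenvalues are taken in the algebraically closed field of complex numbers and counted with
   algebraic multiplicity. *)
definition eigenvalue_mset :: "complex mat \<Rightarrow> complex multiset" where
  "eigenvalue_mset A = proots (char_poly A)"

definition q_spectrum :: "'a pair_pre_digraph \<Rightarrow> 'a list \<Rightarrow> real \<Rightarrow> complex multiset" where
  "q_spectrum G xs q = eigenvalue_mset (similarity_matrix G xs (complex_of_real q))"

definition transition_q_spectrum ::
    "'a pair_pre_digraph \<Rightarrow> 'a list \<Rightarrow> real \<Rightarrow> complex multiset" where
  "transition_q_spectrum G xs q =
     eigenvalue_mset (transition_similarity_matrix G xs (complex_of_real q))"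

(* Distances in a graph are natural numbers, so rat poly fract, i.e. the field of rational functions
   in q over the rationals, already contains all entries of Z(q) and of its inverse; real exponents
   are not needed. The inverse exists for every connected graph, see mat_inverse_formal below. *)
definition formal_magnitude :: "'a pair_pre_digraph \<Rightarrow> 'a list \<Rightarrow> rat poly fract" where
  "formal_magnitude G xs =
     sum_mat (the (mat_inverse (similarity_matrix G xs (to_fract [:0, 1:]))))"

lemma graph_dist_eq_0_iff:
  assumes G: "pair_graph G" and conn: "Digraph_Component.connected (with_proj G)"
    and u: "u \<in> pverts G" and v: "v \<in> pverts G"
  shows "graph_dist G u v = 0 \<longleftrightarrow> u = v"
proof -
  interpret pair_graph G by (rule G)
  have "u \<rightarrow>\<^sup>*\<^bsub>with_proj G\<^esub> v"
    using symmetric_connected_imp_strongly_connected[OF sym_arcs conn] u v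
    by (auto simp: strongly_connected_def)
  then obtain p where p: "apath u p v"
    using reachable_apath by blast
  let ?P = "\<lambda>l. \<exists>p. apath u p v \<and> length p = l"
  have "?P (graph_dist G u v)"
    unfolding graph_dist_def by (rule LeastI[of ?P "length p"]) (use p in blast)
  then have "u = v" if "graph_dist G u v = 0"
    using that by (auto simp: apath_def awalk_def)
  moreover have "graph_dist G u v = 0" if "u = v"
    unfolding graph_dist_def using that u
    by (intro Least_eq_0 exI[of _ "[]"]) (auto simp: apath_def awalk_def)
  ultimately show ?thesis by (rule iffI)
qed

lemma mat_inverse_formal:
  assumes G: "pair_graph G" and conn: "Digraph_Component.connected (with_proj G)"
    and xs: "vertex_enumeration G xs"
  defines "Z \<equiv> similarity_matrix G xs (to_fract ([:0, 1:] :: rat poly))"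
  obtains B where "mat_inverse Z = Some B" "B \<in> carrier_mat (length xs) (length xs)"
    "Z * B = 1\<^sub>m (length xs)" "B * Z = 1\<^sub>m (length xs)"
proof -
  let ?n = "length xs"
  let ?W = "similarity_matrix G xs ([:0, 1:] :: rat poly)"
  have e0: "comm_ring_hom (\<lambda>p :: rat poly. poly p 0)"
    by unfold_locales auto
  interpret tf: comm_ring_hom "to_fract :: rat poly \<Rightarrow> _"
    by unfold_locales auto
  have pow: "(to_fract p :: rat poly fract) ^ d = to_fract (p ^ d)" for p d
    by (induction d) auto
  have ZW: "Z = map_mat to_fract ?W"
    unfolding Z_def similarity_matrix_def by (rule eq_matI) (auto simp: pow)
  have Z: "Z \<in> carrier_mat ?n ?n"
    by (simp add: Z_def similarity_matrix_def)
  have d: "graph_dist G (xs ! i) (xs ! j) = 0 \<longleftrightarrow> i = j" if "i < ?n" "j < ?n" for i j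
  proof -
    have "xs ! i \<in> pverts G" "xs ! j \<in> pverts G"
      using xs that nth_mem[of _ xs] by (auto simp: vertex_enumeration_def)
    then show ?thesis
      using graph_dist_eq_0_iff[OF G conn] xs that
      by (simp add: vertex_enumeration_def nth_eq_iff_index_eq)
  qed
  have "map_mat (\<lambda>p. poly p 0) ?W = 1\<^sub>m ?n"
    by (rule eq_matI) (auto simp: similarity_matrix_def poly_power power_0_left d)
  then have "poly (det ?W) 0 = 1"
    using comm_ring_hom.hom_det[OF e0, of ?W] by simp
  then have "det ?W \<noteq> 0" by auto
  then have "det Z \<noteq> 0"
    by (simp add: ZW)
  then have "Z \<in> Units (ring_mat TYPE(rat poly fract) ?n ())"
    by (rule det_non_zero_imp_unit[OF Z])
  then obtain B where "mat_inverse Z = Some B"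
    using mat_inverse(1)[OF Z, where b = "()"] by (cases "mat_inverse Z") auto
  with mat_inverse(2)[OF Z this] that show ?thesis by blast
qed

end

theory Submission
  imports Defs "Jordan_Normal_Form.Schur_Decomposition"
begin

(* Let A be the adjacency matrix and J the all-ones matrix. Diameter 2 makes Z(q) a combination
   of I, A and J with coefficients depending only on q; it has constant row sums, so P(q) is such
   a combination as well, and the row sum s yields the magnitude n / s. The span of I, A and J is
   closed under multiplication with structure constants given by (n,k,l,m), because
   A^2 = k I + l A + m (J - I - A) and A J = J A = k J. Hence the traces of all powers of Z(q) and
   P(q), i.e. the power sums of the eigenvalues, are determined by the parameters, and
   in characteristic 0 the power sums determine a multiset. *)

section \<open>Power sums of eigenvalues\<close>

text \<open>By linearity, equal power sums give equal sums of every polynomial over \<open>M\<close>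
  and \<open>N\<close>. A polynomial that vanishes at all elements except \<open>a\<close> then
  compares the multiplicities of \<open>a\<close>.\<close>

lemma mset_eq_if_power_sums_eq:
  fixes M N :: "'a::field_char_0 multiset"
  assumes "\<And>j. (\<Sum>x\<in>#M. x ^ j) = (\<Sum>x\<in>#N. x ^ j)"
  shows "M = N"
proof (rule multiset_eqI)
  fix a
  \<comment> \<open>The factor \<open>x ^ j\<close> strengthens the induction:
    \<open>pCons c p\<close> contributes one more factor x, absorbed by applying the hypothesis at
    \<open>Suc j\<close>.\<close>
  have "(\<Sum>x\<in>#M. x ^ j * poly p x) = (\<Sum>x\<in>#N. x ^ j * poly p x)" for p j
  proof (induction p arbitrary: j)
    case (pCons c p)
    have "x ^ j * poly (pCons c p) x = x ^ j * c + x ^ Suc j * poly p x" for x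
      by (simp add: algebra_simps)
    then show ?case
      using assms[of j] pCons.IH[of "Suc j"]
      by (simp add: sum_mset.distrib sum_mset_distrib_right [symmetric] del: poly_pCons)
  qed simp
  from this[of 0] have sum_poly: "(\<Sum>x\<in>#M. poly p x) = (\<Sum>x\<in>#N. poly p x)" for p
    by simp
  (* the sums of p over M and N isolate the multiplicities of a *)
  define p where "p = (\<Prod>b\<in>set_mset (M + N) - {a}. [:- b, 1:])"
  have p0: "poly p x = 0 \<longleftrightarrow> x \<in> set_mset (M + N) - {a}" for x
    by (auto simp: p_def poly_prod)
  have "(\<Sum>x\<in>#K. poly p x) = of_nat (count K a) * poly p a" if "set_mset K \<subseteq> set_mset (M + N)" for K
    using that
  proof (induction K)
    case (add x K)
    then show ?case using p0[of x] by (auto simp: algebra_simps)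
  qed simp
  from this[of M] this[of N] have "of_nat (count M a) * poly p a = of_nat (count N a) * poly p a"
    using sum_poly[of p] by (metis set_mset_union sup_ge1 sup_ge2)
  moreover have "poly p a \<noteq> 0"
    using p0 by blast
  \<comment> \<open>Characteristic 0 enters here: \<open>of_nat\<close> is injective, so equal
    images give equal multiplicities.\<close>
  ultimately show "count M a = count N a"
    by simp
qed

section \<open>Traces of matrix powers\<close>

definition trace_mat :: "'a::comm_monoid_add mat \<Rightarrow> 'a" where
  "trace_mat A = (\<Sum>i<dim_row A. A $$ (i, i))"

lemma trace_mat_mult_comm:
  fixes A B :: "'a::comm_semiring_0 mat"
  assumes "A \<in> carrier_mat n m" "B \<in> carrier_mat m n"
  shows "trace_mat (A * B) = trace_mat (B * A)"
proof -
  have "trace_mat (A * B) = (\<Sum>i<n. \<Sum>r<m. A $$ (i, r) * B $$ (r, i))"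
    using assms by (auto simp: trace_mat_def scalar_prod_def atLeast0LessThan intro!: sum.cong)
  also have "\<dots> = (\<Sum>r<m. \<Sum>i<n. A $$ (i, r) * B $$ (r, i))"
    by (rule sum.swap)
  also have "\<dots> = trace_mat (B * A)"
    using assms
    by (auto simp: trace_mat_def scalar_prod_def atLeast0LessThan mult.commute intro!: sum.cong)
  finally show ?thesis .
qed

lemma trace_mat_similar:
  fixes A B :: "'a::comm_ring_1 mat"
  assumes "similar_mat A B"
  shows "trace_mat A = trace_mat B"
proof -
  from similar_matD[OF assms] obtain n P Q where
    carr: "{A, B, P, Q} \<subseteq> carrier_mat n n" and QP: "Q * P = 1\<^sub>m n" and A: "A = P * B * Q"
    by blast
  have "trace_mat A = trace_mat (Q * (P * B))"
    using carr unfolding A by (intro trace_mat_mult_comm[of _ n n]) auto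
  also have "Q * (P * B) = B"
    using carr by (subst assoc_mult_mat[symmetric, of _ n n _ n _ n]) (auto simp: QP)
  finally show ?thesis .
qed

text \<open>The two claims are proved together, because the diagonal of the next power is computed
  from the triangular shape of the previous one.\<close>

lemma upper_triangular_pow:
  fixes B :: "'a::semiring_1 mat"
  assumes B: "B \<in> carrier_mat n n" and tri: "upper_triangular B"
  shows "upper_triangular (B ^\<^sub>m j) \<and> (\<forall>i<n. (B ^\<^sub>m j) $$ (i, i) = B $$ (i, i) ^ j)"
proof (induction j)
  case 0
  show ?case using B by auto
next
  case (Suc j)
  have C: "B ^\<^sub>m j \<in> carrier_mat n n" using B by simp
  have entry: "(B ^\<^sub>m Suc j) $$ (i, i') = (\<Sum>r<n. (B ^\<^sub>m j) $$ (i, r) * B $$ (r, i'))"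
    if "i < n" "i' < n" for i i'
    using that B C by (simp add: scalar_prod_def atLeast0LessThan)
  \<comment> \<open>A summand survives only for i \<le> r \<le> i'. On the diagonal this leaves r =
    i alone, below the diagonal nothing.\<close>
  have zero: "(B ^\<^sub>m j) $$ (i, r) * B $$ (r, i') = 0" if "i < n" "r < n" "r < i \<or> i' < r" for i i' r
    using that(3)
  proof
    assume "r < i"
    then have "(B ^\<^sub>m j) $$ (i, r) = 0"
      using upper_triangularD[of "B ^\<^sub>m j" r i] Suc.IH C that by auto
    then show ?thesis by simp
  next
    assume "i' < r"
    then have "B $$ (r, i') = 0"
      using upper_triangularD[OF tri, of i' r] B that by auto
    then show ?thesis by simp
  qed
  have "(B ^\<^sub>m Suc j) $$ (i, i) = B $$ (i, i) ^ Suc j" if i: "i < n" for i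
  proof -
    have "(\<Sum>r<n. (B ^\<^sub>m j) $$ (i, r) * B $$ (r, i)) = (\<Sum>r\<in>{i}. (B ^\<^sub>m j) $$ (i, r) * B $$ (r, i))"
      using i by (intro sum.mono_neutral_right) (auto intro!: zero)
    then show ?thesis
      using entry[OF i i] Suc.IH i by (simp add: power_commutes)
  qed
  moreover have "upper_triangular (B ^\<^sub>m Suc j)"
  proof (rule upper_triangularI)
    fix i' i assume "i' < i" "i < dim_row (B ^\<^sub>m Suc j)"
    then have i: "i' < i" "i < n" using B by auto
    have "(\<Sum>r<n. (B ^\<^sub>m j) $$ (i, r) * B $$ (r, i')) = 0"
      using i by (intro sum.neutral) (auto intro!: zero)
    then show "(B ^\<^sub>m Suc j) $$ (i, i') = 0"
      using entry i by simp
  qed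
  ultimately show ?case by blast
qed

text \<open>Over the complex numbers A is similar to a triangular matrix whose diagonal lists the
  eigenvalues with multiplicity. Similarity passes to powers, and the diagonal of a power consists
  of the powers of the eigenvalues.\<close>

lemma trace_mat_pow_eq_power_sum:
  assumes A: "A \<in> carrier_mat n n"
  shows "trace_mat (A ^\<^sub>m j) = (\<Sum>e\<in>#eigenvalue_mset A. e ^ j)"
proof -
  obtain es where "char_poly A = (\<Prod>e\<leftarrow>es. [:- e, 1:])"
    using char_poly_factorized[OF A] by blast
  then obtain B where B: "B \<in> carrier_mat n n" "upper_triangular B" "similar_mat A B"
    using schur_decomposition_exists[OF A] by blast
  have "char_poly A = (\<Prod>e\<leftarrow>diag_mat B. [:- e, 1:])"
    using char_poly_similar[OF B(3)] char_poly_upper_triangular[OF B(1,2)] by simp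
  moreover have "proots (\<Prod>e\<leftarrow>es. [:- e, 1:]) = mset es" for es :: "complex list"
  proof (induction es)
    case (Cons e es)
    have "(\<Prod>e\<leftarrow>es. [:- e, 1:]) \<noteq> 0"
      by (auto simp: prod_list_zero_iff)
    with Cons.IH show ?case
      using proots_mult[of "[:- e, 1:]" "\<Prod>e\<leftarrow>es. [:- e, 1:]"] by (simp del: mult_pCons_left)
  qed simp
  ultimately have mset: "eigenvalue_mset A = mset (diag_mat B)"
    by (simp add: eigenvalue_mset_def)
  have "similar_mat (A ^\<^sub>m j) (B ^\<^sub>m j)"
    using B(3) similar_mat_wit_pow unfolding similar_mat_def by blast
  then have "trace_mat (A ^\<^sub>m j) = trace_mat (B ^\<^sub>m j)"
    by (rule trace_mat_similar)
  also have "\<dots> = (\<Sum>i<n. B $$ (i, i) ^ j)"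
    using upper_triangular_pow[OF B(1,2)] B(1) by (simp add: trace_mat_def)
  also have "\<dots> = (\<Sum>e\<in>#mset (diag_mat B). e ^ j)"
    using B(1) by (simp add: diag_mat_def interv_sum_list_conv_sum_set_nat atLeast0LessThan
        sum_mset_sum_list comp_def flip: mset_map)
  finally show ?thesis by (simp add: mset)
qed

lemma eigenvalue_mset_eqI:
  assumes "A \<in> carrier_mat n n" "B \<in> carrier_mat n' n'"
    and "\<And>j. trace_mat (A ^\<^sub>m j) = trace_mat (B ^\<^sub>m j)"
  shows "eigenvalue_mset A = eigenvalue_mset B"
  using assms by (intro mset_eq_if_power_sums_eq) (simp add: trace_mat_pow_eq_power_sum)

section \<open>Distances in graphs of diameter 2\<close>

text \<open>Connectedness supplies some path, so the \<open>LEAST\<close> in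
  \<open>graph_dist\<close> ranges over a nonempty set and its value is a genuine path
  length.\<close>

lemma graph_dist_attained:
  assumes G: "pair_graph G" and conn: "Digraph_Component.connected (with_proj G)"
    and u: "u \<in> pverts G" and v: "v \<in> pverts G"
  obtains p where "pre_digraph.apath (with_proj G) u p v" "length p = graph_dist G u v"
proof -
  interpret pair_graph G by (rule G)
  have "u \<rightarrow>\<^sup>*\<^bsub>with_proj G\<^esub> v"
    using symmetric_connected_imp_strongly_connected[OF sym_arcs conn] u v
    by (auto simp: strongly_connected_def)
  then obtain p where p: "apath u p v"
    using reachable_apath by blast
  let ?P = "\<lambda>l. \<exists>p. apath u p v \<and> length p = l"
  have "?P (graph_dist G u v)"
    unfolding graph_dist_def by (rule LeastI[of ?P "length p"]) (use p in blast)
  then show thesis using that by blast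
qed

lemma graph_dist_eq_1_iff:
  assumes G: "pair_graph G" and conn: "Digraph_Component.connected (with_proj G)"
    and u: "u \<in> pverts G" and v: "v \<in> pverts G"
  shows "graph_dist G u v = 1 \<longleftrightarrow> (u, v) \<in> parcs G"
proof
  interpret pair_graph G by (rule G)
  assume "graph_dist G u v = 1"
  then obtain p where p: "apath u p v" "length p = 1"
    using graph_dist_attained[OF G conn u v] by metis
  then obtain e where "p = [e]" by (cases p) auto
  with p show "(u, v) \<in> parcs G"
    by (cases e) (auto simp: apath_def awalk_def)
next
  interpret pair_graph G by (rule G)
  assume uv: "(u, v) \<in> parcs G"
  then have neq: "u \<noteq> v" using no_loops by fastforce
  with uv u v have "apath u [(u, v)] v"
    by (auto simp: apath_def awalk_def)
  then have "graph_dist G u v \<le> 1"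
    unfolding graph_dist_def by (intro Least_le exI[of _ "[(u, v)]"]) simp
  \<comment> \<open>The single arc bounds the distance by 1, and distance 0 is excluded because the
    graph has no loops.\<close>
  with neq show "graph_dist G u v = 1"
    using graph_dist_eq_0_iff[OF G conn u v] by linarith
qed

lemma graph_dist_le_diameter:
  assumes "finite (pverts G)" "u \<in> pverts G" "v \<in> pverts G"
  shows "graph_dist G u v \<le> diameter G"
proof -
  \<comment> \<open>Writing the set as the image of a finite product shows that the
    \<open>Max\<close> is taken over a finite set.\<close>
  have "{graph_dist G u v | u v. u \<in> pverts G \<and> v \<in> pverts G} =
      (\<lambda>(u, v). graph_dist G u v) ` (pverts G \<times> pverts G)"
    by auto
  then show ?thesis
    unfolding diameter_def using assms by (intro Max_ge) auto
qed

lemma out_degree_pair_graph: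
  assumes "pair_graph G"
  shows "out_degree (with_proj G) u = card {w \<in> pverts G. (u, w) \<in> parcs G}"
proof -
  interpret pair_graph G by (rule assms)
  have "out_arcs (with_proj G) u = Pair u ` {w \<in> pverts G. (u, w) \<in> parcs G}"
    using head_in_verts by (force simp: out_arcs_def)
  then show ?thesis
    by (simp add: out_degree_def card_image inj_on_def)
qed

section \<open>The matrix algebra of a strongly regular graph\<close>

text \<open>With 1 the all-ones vector, A 1 = s 1 and B A = I give s (B 1) = 1, so each of the n
  rows of B sums to 1 / s.\<close>

lemma sum_mat_left_inverse:
  fixes A B :: "'a::field mat"
  assumes A: "A \<in> carrier_mat n n" and B: "B \<in> carrier_mat n n" and BA: "B * A = 1\<^sub>m n"
    and rows: "\<And>i. i < n \<Longrightarrow> (\<Sum>j<n. A $$ (i, j)) = s"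
  shows "sum_mat B = of_nat n / s"
proof -
  have row: "(\<Sum>r<n. B $$ (i, r)) * s = 1" if i: "i < n" for i
  proof -
    have "(\<Sum>r<n. B $$ (i, r)) * s = (\<Sum>r<n. \<Sum>j<n. B $$ (i, r) * A $$ (r, j))"
      by (simp add: sum_distrib_right sum_distrib_left[symmetric] rows)
    also have "\<dots> = (\<Sum>j<n. (B * A) $$ (i, j))"
      using A B i by (subst sum.swap) (simp add: scalar_prod_def atLeast0LessThan)
    also have "\<dots> = 1"
      using i by (simp add: BA)
    finally show ?thesis .
  qed
  have "sum_mat B = (\<Sum>i<n. \<Sum>r<n. B $$ (i, r))"
    using B by (simp add: sum_mat_def sum.cartesian_product atLeast0LessThan)
  also have "\<dots> = (\<Sum>i<n. 1 / s)"
  proof (rule sum.cong)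
    fix i assume "i \<in> {..<n}"
    then have r: "(\<Sum>r<n. B $$ (i, r)) * s = 1" using row by simp
    \<comment> \<open>Nonvanishing of s comes from an actual row; for n = 0 the outer sum is
      empty.\<close>
    then have "s \<noteq> 0" by auto
    with r show "(\<Sum>r<n. B $$ (i, r)) = 1 / s" by (simp add: field_simps)
  qed simp
  finally show ?thesis by simp
qed

locale enumerated_srg =
  fixes G :: "'a pair_pre_digraph" and n k l m :: nat and xs :: "'a list"
  assumes srg: "strongly_regular G n k l m"
    and enum: "vertex_enumeration G xs"
begin

lemma pair_graph: "pair_graph G"
  using srg by (simp add: strongly_regular_def)

lemma length_xs: "length xs = n"
  using srg enum by (metis distinct_card strongly_regular_def vertex_enumeration_def)

lemma nth_in_pverts: "i < n \<Longrightarrow> xs ! i \<in> pverts G"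
  using enum length_xs nth_mem[of i xs] by (simp add: vertex_enumeration_def)

lemma nth_eq_iff: "i < n \<Longrightarrow> j < n \<Longrightarrow> xs ! i = xs ! j \<longleftrightarrow> i = j"
  using enum length_xs by (simp add: vertex_enumeration_def nth_eq_iff_index_eq)

definition adj :: "nat \<Rightarrow> nat \<Rightarrow> bool" where
  "adj i j \<longleftrightarrow> (xs ! i, xs ! j) \<in> parcs G"

lemma adj_sym: "adj i j \<longleftrightarrow> adj j i"
proof -
  interpret pair_graph G by (rule pair_graph)
  show ?thesis
    using sym_arcs by (auto simp: adj_def symmetric_def dest: symD)
qed

lemma adj_irrefl [simp]: "\<not> adj i i"
proof -
  interpret pair_graph G by (rule pair_graph)
  show ?thesis
    using no_loops by (fastforce simp: adj_def)
qed

text \<open>Transfers the neighbour counts of \<open>strongly_regular\<close> from vertices to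
  matrix indices along the bijection given by \<open>xs\<close>.\<close>

lemma card_indices:
  "card {i. i < n \<and> Q (xs ! i)} = card {w \<in> pverts G. Q w}"
proof -
  have "set xs = (!) xs ` {..<n}"
    by (auto simp: set_conv_nth length_xs[symmetric])
  then have "pverts G = (!) xs ` {..<n}"
    using enum by (simp add: vertex_enumeration_def)
  then have "{w \<in> pverts G. Q w} = (!) xs ` {i. i < n \<and> Q (xs ! i)}"
    by auto
  moreover have "inj_on ((!) xs) {i. i < n \<and> Q (xs ! i)}"
    using nth_eq_iff by (auto simp: inj_on_def)
  ultimately show ?thesis
    by (simp add: card_image)
qed

lemma sum_adj:
  assumes "i < n"
  shows "(\<Sum>r<n. of_bool (adj i r)) = (of_nat k :: 'b::semiring_1)"
proof -
  have "(\<Sum>r<n. of_bool (adj i r)) = (of_nat (card {r. r < n \<and> adj i r}) :: 'b)"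
    by (simp add: of_bool_def sum.If_cases Int_def)
  also have "card {r. r < n \<and> adj i r} = k"
    using card_indices[of "\<lambda>w. (xs ! i, w) \<in> parcs G"] srg nth_in_pverts[OF assms]
      out_degree_pair_graph[OF pair_graph]
    by (simp add: strongly_regular_def adj_def)
  finally show ?thesis .
qed

text \<open>The (i, j) entry of A^2 counts common neighbours: k on the diagonal, l for adjacent and
  m for other pairs. The right side collects this by I, A and J, with the differences taken in the
  ring to avoid truncated subtraction.\<close>

lemma sum_adj_adj:
  assumes "i < n" "j < n"
  shows "(\<Sum>r<n. of_bool (adj i r) * of_bool (adj r j)) =
    ((of_nat k - of_nat m) * of_bool (i = j) + (of_nat l - of_nat m) * of_bool (adj i j) + of_nat m
      :: 'b::comm_ring_1)"
proof (cases "i = j")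
  case True
  then show ?thesis
    using sum_adj[OF assms(1), where 'b = 'b] adj_sym[of _ j]
    by (simp flip: of_bool_conj)
next
  case False
  have "(\<Sum>r<n. of_bool (adj i r) * of_bool (adj r j)) =
      (\<Sum>r<n. of_bool (adj i r \<and> adj j r) :: 'b)"
    by (simp add: adj_sym[of _ j] of_bool_conj)
  also have "\<dots> = of_nat (card {r. r < n \<and> adj i r \<and> adj j r})"
    unfolding of_bool_def by (simp add: sum.If_cases Int_def)
  also have "card {r. r < n \<and> adj i r \<and> adj j r} = (if adj i j then l else m)"
    using card_indices[of "\<lambda>w. (xs ! i, w) \<in> parcs G \<and> (xs ! j, w) \<in> parcs G"] srg
      nth_in_pverts[OF assms(1)] nth_in_pverts[OF assms(2)] nth_eq_iff[OF assms] False
    by (simp add: strongly_regular_def adj_def)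
  finally show ?thesis using False by simp
qed

text \<open>This is x I + y A + z J, with A the adjacency matrix and J the all-ones matrix.\<close>

definition comb :: "'b \<Rightarrow> 'b \<Rightarrow> 'b \<Rightarrow> 'b::comm_ring_1 mat" where
  "comb x y z = mat n n (\<lambda>(i, j). x * of_bool (i = j) + y * of_bool (adj i j) + z)"

lemma comb_carrier [simp]: "comb x y z \<in> carrier_mat n n"
  by (simp add: comb_def)

lemma one_mat_eq_comb: "1\<^sub>m n = comb 1 0 0"
  by (rule eq_matI) (auto simp: comb_def)

lemma trace_comb: "trace_mat (comb x y z) = of_nat n * (x + z)"
  by (simp add: trace_mat_def comb_def)

lemma row_sum_comb:
  assumes "i < n"
  shows "(\<Sum>j<n. comb x y z $$ (i, j)) = x + y * of_nat k + of_nat n * z"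
proof -
  have "(\<Sum>j<n. comb x y z $$ (i, j)) =
      (\<Sum>j<n. x * of_bool (i = j)) + y * (\<Sum>j<n. of_bool (adj i j)) + of_nat n * z"
    using assms by (simp add: comb_def sum.distrib sum_distrib_left del: sum_of_bool_eq)
  then show ?thesis
    using assms by (simp only: sum_adj) (simp add: of_bool_def if_distrib cong: if_cong)
qed

text \<open>Expand the product using the formula for A^2, A J = J A = k J and J^2 = n J. What
  matters later is that the resulting coefficients involve the graph only through n, k, l and
  m.\<close>

lemma comb_mult:
  "comb x y z * comb x' y' z' =
    comb (x * x' + y * y' * (of_nat k - of_nat m))
      (x * y' + y * x' + y * y' * (of_nat l - of_nat m))
      (x * z' + z * x' + y * y' * of_nat m + (y * z' + z * y') * of_nat k + z * z' * of_nat n)"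
  (is "_ = ?C")
proof (rule eq_matI)
  fix i j assume "i < dim_row ?C" "j < dim_col ?C"
  then have ij: "i < n" "j < n" by (simp_all add: comb_def)
  let ?d = "\<lambda>i j. of_bool (i = j)" and ?a = "\<lambda>i j. of_bool (adj i j)"
  have "(comb x y z * comb x' y' z') $$ (i, j) =
      (\<Sum>r<n. (x * ?d i r + y * ?a i r + z) * (x' * ?d r j + y' * ?a r j + z'))"
    using ij by (simp add: comb_def scalar_prod_def atLeast0LessThan)
  \<comment> \<open>Terms containing a Kronecker delta are split off, since each such sum collapses
    to a single index.\<close>
  also have "\<dots> = (\<Sum>r<n. ?d i r * (x * (x' * ?d r j + y' * ?a r j + z')) +
      ?d r j * (x' * (y * ?a i r + z)) +
      y * y' * (?a i r * ?a r j) + y * z' * ?a i r + z * y' * ?a r j + z * z')"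
    by (rule sum.cong) (simp_all add: algebra_simps)
  also have "\<dots> = x * (x' * ?d i j + y' * ?a i j + z') + x' * (y * ?a i j + z) +
      y * y' * (\<Sum>r<n. ?a i r * ?a r j) + y * z' * (\<Sum>r<n. ?a i r) + z * y' * (\<Sum>r<n. ?a r j) +
      of_nat n * (z * z')"
  proof -
    have d: "(\<Sum>r<n. ?d i r * f r) = f i" "(\<Sum>r<n. ?d r j * f r) = f j" for f :: "nat \<Rightarrow> 'b"
      using ij by (auto simp: of_bool_def if_distrib[of "\<lambda>c. c * _"] cong: if_cong)
    show ?thesis
      by (simp only: sum.distrib d sum_distrib_left sum_constant card_lessThan)
  qed
  \<comment> \<open>Column sums equal row sums by symmetry of adjacency, that is, J A = k J.\<close>
  also have "(\<Sum>r<n. ?a r j) = (of_nat k :: 'b)"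
    using sum_adj[OF ij(2)] by (simp only: adj_sym[of _ j])
  finally show "(comb x y z * comb x' y' z') $$ (i, j) = ?C $$ (i, j)"
    using ij by (simp only: sum_adj sum_adj_adj) (simp add: comb_def algebra_simps)
qed (simp_all add: comb_def)

end

section \<open>Comparison of two graphs with the same parameters\<close>

lemma comb_pow_simultaneous:
  assumes "enumerated_srg G n k l m xs" and "enumerated_srg H n k l m ys"
  shows "\<exists>x' y' z'. enumerated_srg.comb G n xs x y z ^\<^sub>m j = enumerated_srg.comb G n xs x' y' z' \<and>
    enumerated_srg.comb H n ys x y z ^\<^sub>m j = enumerated_srg.comb H n ys x' y' z'"
proof -
  interpret G: enumerated_srg G n k l m xs by fact
  interpret H: enumerated_srg H n k l m ys by fact
  show ?thesis
  proof (induction j)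
    case 0
    show ?case
      using G.one_mat_eq_comb H.one_mat_eq_comb
      by (auto simp: carrier_matD[OF G.comb_carrier] carrier_matD[OF H.comb_carrier])
  next
    case (Suc j)
    \<comment> \<open>The coefficients in \<open>comb_mult\<close> are the same expressions for both
      graphs, so one triple of witnesses serves both powers.\<close>
    then show ?case
      using G.comb_mult H.comb_mult by (metis pow_mat.simps(2))
  qed
qed

text \<open>Corresponding powers have common coefficients, and \<open>trace_comb\<close> depends
  only on n and these coefficients; hence all power traces agree.\<close>

lemma eigenvalue_mset_comb_eq:
  assumes "enumerated_srg G n k l m xs" and "enumerated_srg H n k l m ys"
  shows "eigenvalue_mset (enumerated_srg.comb G n xs x y z) =
    eigenvalue_mset (enumerated_srg.comb H n ys x y z)"
proof -
  interpret G: enumerated_srg G n k l m xs by fact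
  interpret H: enumerated_srg H n k l m ys by fact
  show ?thesis
    by (rule eigenvalue_mset_eqI[OF G.comb_carrier H.comb_carrier])
      (metis comb_pow_simultaneous[OF assms] G.trace_comb H.trace_comb)
qed

section \<open>Similarity matrices in diameter 2\<close>

locale enumerated_srg_diameter_2 = enumerated_srg +
  assumes conn: "Digraph_Component.connected (with_proj G)"
    and diam: "diameter G = 2"
begin

lemma graph_dist_nth:
  assumes "i < n" "j < n"
  shows "graph_dist G (xs ! i) (xs ! j) = (if i = j then 0 else if adj i j then 1 else 2)"
proof -
  interpret pair_graph G by (rule pair_graph)
  have V: "xs ! i \<in> pverts G" "xs ! j \<in> pverts G"
    using assms nth_in_pverts by auto
  show ?thesis
    using graph_dist_eq_0_iff[OF pair_graph conn V] graph_dist_eq_1_iff[OF pair_graph conn V]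
      graph_dist_le_diameter[of G, OF _ V] diam nth_eq_iff[OF assms] finite_verts
    by (auto simp: adj_def)
qed

text \<open>Distinct non-adjacent vertices are at distance 2, so Z(q) = I + q A + q^2 (J - I - A),
  regrouped by I, A and J.\<close>

lemma similarity_matrix_eq_comb:
  "similarity_matrix G xs q = comb (1 - q\<^sup>2) (q - q\<^sup>2) (q\<^sup>2)"
  by (rule eq_matI) (auto simp: similarity_matrix_def comb_def length_xs graph_dist_nth)

text \<open>The value of \<open>row_sum_comb\<close> at the coefficients of Z(q), hence the common
  value of all row sums.\<close>

definition row_sum :: "'b::comm_ring_1 \<Rightarrow> 'b" where
  "row_sum q = 1 - q\<^sup>2 + (q - q\<^sup>2) * of_nat k + of_nat n * q\<^sup>2"

lemma similarity_matrix_row_sum: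
  assumes "i < n"
  shows "(\<Sum>j<n. similarity_matrix G xs q $$ (i, j)) = row_sum q"
  using assms by (simp add: similarity_matrix_eq_comb row_sum_comb row_sum_def)

text \<open>Since all row sums coincide, normalising the rows is division of Z(q) by one scalar.
  Where that scalar is 0, both sides are 0 by the convention for division by 0.\<close>

lemma transition_similarity_matrix_eq_comb:
  "transition_similarity_matrix G xs q =
    comb ((1 - q\<^sup>2) / row_sum q) ((q - q\<^sup>2) / row_sum q) (q\<^sup>2 / row_sum q)"
    (is "_ = ?C")
proof (rule eq_matI)
  fix i j assume "i < dim_row ?C" "j < dim_col ?C"
  then have ij: "i < n" "j < n" by (simp_all add: comb_def)
  have "(\<Sum>r<n. q ^ graph_dist G (xs ! i) (xs ! r)) = row_sum q"
    using similarity_matrix_row_sum[OF ij(1), of q] ij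
    by (simp add: similarity_matrix_def length_xs)
  then have "transition_similarity_matrix G xs q $$ (i, j) =
      similarity_matrix G xs q $$ (i, j) / row_sum q"
    using ij by (simp add: transition_similarity_matrix_def similarity_matrix_def length_xs)
  then show "transition_similarity_matrix G xs q $$ (i, j) = ?C $$ (i, j)"
    using ij by (simp add: similarity_matrix_eq_comb comb_def add_divide_distrib)
qed (simp_all add: transition_similarity_matrix_def comb_def length_xs)

lemma formal_magnitude_eq: "formal_magnitude G xs = of_nat n / row_sum (to_fract [:0, 1:])"
proof -
  let ?Z = "similarity_matrix G xs (to_fract ([:0, 1:] :: rat poly))"
  obtain B where B: "mat_inverse ?Z = Some B" "B \<in> carrier_mat n n" "B * ?Z = 1\<^sub>m n"
    using mat_inverse_formal[OF pair_graph conn enum] length_xs by metis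
  have "sum_mat B = of_nat n / row_sum (to_fract [:0, 1:])"
    by (rule sum_mat_left_inverse[OF _ B(2,3) similarity_matrix_row_sum])
      (simp_all add: similarity_matrix_eq_comb)
  then show ?thesis
    by (simp add: formal_magnitude_def B(1))
qed

end

theorem proposition5p1:
  fixes G :: "'a pair_pre_digraph" and H :: "'b pair_pre_digraph"
    and n k l m :: nat and xs :: "'a list" and ys :: "'b list"
  assumes "strongly_regular G n k l m" and "strongly_regular H n k l m"
    and "Digraph_Component.connected (with_proj G)"
    and "Digraph_Component.connected (with_proj H)"
    and "diameter G = 2" and "diameter H = 2"
    and "vertex_enumeration G xs" and "vertex_enumeration H ys"
  shows "formal_magnitude G xs = formal_magnitude H ys \<and>
    (\<forall>q \<in> {0<..<1}. q_spectrum G xs q = q_spectrum H ys q) \<and>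
    (\<forall>q \<in> {0<..<1}. transition_q_spectrum G xs q = transition_q_spectrum H ys q)"
proof -
  interpret G: enumerated_srg_diameter_2 G n k l m xs
    using assms by unfold_locales
  interpret H: enumerated_srg_diameter_2 H n k l m ys
    using assms by unfold_locales
  have spec: "eigenvalue_mset (G.comb x y z) = eigenvalue_mset (H.comb x y z)" for x y z
    by (rule eigenvalue_mset_comb_eq) (rule G.enumerated_srg_axioms H.enumerated_srg_axioms)+
  show ?thesis
    \<comment> \<open>After unfolding, \<open>row_sum\<close> and the \<open>comb\<close>
      coefficients are identical expressions in n, k and q for both graphs, and \<open>spec\<close>
      exchanges the graphs in the two spectra.\<close>
    by (simp only: G.formal_magnitude_eq H.formal_magnitude_eq G.row_sum_def H.row_sum_def spec
        q_spectrum_def G.similarity_matrix_eq_comb H.similarity_matrix_eq_comb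
        transition_q_spectrum_def G.transition_similarity_matrix_eq_comb
        H.transition_similarity_matrix_eq_comb) simp
qed

end
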